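(* Let $\pi^C$ (given by $(\bm v,K)$) be an optimal solution of the state-history-affine problem $$\min_{\bm v,K}\ J(\bm v,K)\quad\text{s.t.}\quad g_x(\mathbb{E}[x_k],\mathrm{Cov}(x_k))\le 0\ (k=1,\dots,N),\quad g_u(\mathbb{E}[u_k],\mathrm{Cov}(u_k))\le 0\ (k=0,\dots,N-1),$$ where the minimization is over all $\bm v=(v_0,\dots,v_{N-1})$ and all gains $K=\{K_{k,i}\}_{0\le i\le k\le N-1}$, with no further restriction, and $g_x,g_u$ are covariance-monotonic. Let $x_0,\dots,x_N$ be the state trajectory under $\pi^C$, and let $\pi^M$ be the Markovian policy constructed from $\pi^C$, i.e. $\pi^M_k(x_k)=v_k+H_k(x_k-\mu_k)$ with $H_k=P_{ux,k}P_{x,k}^\dagger$. Then $$\pi_k^C(x_0,\dots,x_k)=\pi_k^M(x_k)\quad\text{almost surely},\qquad k=0,\dots,N-1.$$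
   Context: System: for $k=0,\dots,N-1$, $x_{k+1}=A_kx_k+B_ku_k+G_kw_k$ with $x_k\in\mathbb{R}^n$, $u_k\in\mathbb{R}^m$, $w_k\in\mathbb{R}^l$, where $w_0,\dots,w_{N-1}$ are i.i.d. $\mathcal N(0,I_l)$, and $x_0\sim\mathcal N(\mu_0,P_0)$, $P_0\succeq0$, is independent of $\{w_k\}$. State-history-affine policy $\pi^C$: $u_k=\pi^C_k(x_0,\dots,x_k)=v_k+\sum_{i=0}^kK_{k,i}(x_i-\mathbb{E}[x_i])$, with $v_k\in\mathbb{R}^m$, $K_{k,i}\in\mathbb{R}^{m\times n}$. Under it, write $\mu_k=\mathbb{E}[x_k]$ (and $\mathbb{E}[u_k]=v_k$), $P_{x,k}=\mathrm{Cov}(x_k)$, $P_{u,k}=\mathrm{Cov}(u_k)$, $P_{ux,k}=\mathbb{E}[(u_k-v_k)(x_k-\mu_k)^\top]$. The means $\mu_k$ depend only on $\bm v$, not on the gains. Cost: $J=\sum_{k=0}^N\mathbb{E}[x_k^\top Q_kx_k]+\sum_{k=0}^{N-1}\mathbb{E}[u_k^\top R_ku_k]$ with $Q_k\succeq0$, $R_k\succ0$ symmetric. Covariance-monotonic: a function $g:\mathbb{R}^d\times\mathbb{S}_+^d\to\mathbb{R}$ (where $\mathbb{S}^d_+$ is the set of symmetric positive semidefinite $d\times d$ matrices) defining a constraint $g(\mu,P)\le0$ is covariance-monotonic if $P_1\preceq P_2$ implies $g(\mu,P_1)\le g(\mu,P_2)$ for every $\mu$. Here $g_x$ is defined on $\mathbb{R}^n\times\mathbb{S}_+^n$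 and $g_u$ on $\mathbb{R}^m\times\mathbb{S}_+^m$. $X^\dagger$ denotes the Moore–Penrose pseudoinverse. *)

theory Defs
  imports "HOL-Probability.Probability"
begin

section \<open>Matrices\<close>

definition psd :: "real^'d^'d \<Rightarrow> bool"
  where "psd A \<longleftrightarrow> transpose A = A \<and> (\<forall>z. 0 \<le> z \<bullet> (A *v z))"

definition pos_def :: "real^'d^'d \<Rightarrow> bool"
  where "pos_def A \<longleftrightarrow> transpose A = A \<and> (\<forall>z. z \<noteq> 0 \<longrightarrow> 0 < z \<bullet> (A *v z))"

definition loewner_le :: "real^'d^'d \<Rightarrow> real^'d^'d \<Rightarrow> bool"
  where "loewner_le A B \<longleftrightarrow> psd (B - A)"

definition outer :: "real^'a \<Rightarrow> real^'b \<Rightarrow> real^'b^'a"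
  where "outer a b = (\<chi> i j. a $ i * b $ j)"

definition is_pinv :: "real^'n^'m \<Rightarrow> real^'m^'n \<Rightarrow> bool"
  where "is_pinv A X \<longleftrightarrow>
    A ** X ** A = A \<and> X ** A ** X = X \<and>
    transpose (A ** X) = A ** X \<and> transpose (X ** A) = X ** A"

text \<open>The four Penrose conditions have exactly one solution for every real matrix, so the
  description below is always proper. Uniqueness is the next lemma.\<close>

definition pinv :: "real^'n^'m \<Rightarrow> real^'m^'n"
  where "pinv A = (THE X. is_pinv A X)"

lemma is_pinv_unique:
  assumes X: "is_pinv A X" and Y: "is_pinv A Y"
  shows "X = Y"
proof -
  have AXY: "A ** X = A ** Y"
  proof -
    have "A ** X = transpose (A ** X)"
      using X by (simp add: is_pinv_def)
    also have "\<dots> = transpose ((A ** Y) ** (A ** X))"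
      using Y by (simp add: is_pinv_def matrix_mul_assoc)
    also have "\<dots> = (A ** X) ** (A ** Y)"
      using X Y by (simp add: is_pinv_def matrix_transpose_mul)
    also have "\<dots> = A ** Y"
      using X by (simp add: is_pinv_def matrix_mul_assoc)
    finally show ?thesis .
  qed
  have XYA: "X ** A = Y ** A"
  proof -
    have "X ** A = transpose (X ** A)"
      using X by (simp add: is_pinv_def)
    also have "\<dots> = transpose ((X ** A) ** (Y ** A))"
      using Y by (metis is_pinv_def matrix_mul_assoc)
    also have "\<dots> = (Y ** A) ** (X ** A)"
      using X Y by (simp add: is_pinv_def matrix_transpose_mul)
    also have "\<dots> = Y ** A"
      using X by (metis is_pinv_def matrix_mul_assoc)
    finally show ?thesis .
  qed
  have "X = X ** A ** X" using X by (simp add: is_pinv_def)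
  also have "\<dots> = Y ** A ** Y"
    by (metis AXY XYA matrix_mul_assoc)
  also have "\<dots> = Y" using Y by (simp add: is_pinv_def)
  finally show ?thesis .
qed

text \<open>Only the values of \<open>g\<close> at positive semidefinite second arguments matter, which renders
  a function on vectors times the positive semidefinite cone.\<close>

definition covariance_monotonic :: "(real^'d \<Rightarrow> real^'d^'d \<Rightarrow> real) \<Rightarrow> bool"
  where "covariance_monotonic g \<longleftrightarrow>
    (\<forall>\<mu> P1 P2. psd P1 \<longrightarrow> psd P2 \<longrightarrow> loewner_le P1 P2 \<longrightarrow> g \<mu> P1 \<le> g \<mu> P2)"


section \<open>Random vectors\<close>

definition covariance :: "'w measure \<Rightarrow> ('w \<Rightarrow> real^'d) \<Rightarrow> real^'d^'d"
  where "covariance M X =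
    (LINT \<omega>|M. outer (X \<omega> - integral\<^sup>L M X) (X \<omega> - integral\<^sup>L M X))"

text \<open>The one-dimensional normal law with given mean and variance; variance zero gives the
  point mass.\<close>

definition normal_law :: "real \<Rightarrow> real \<Rightarrow> real measure"
  where "normal_law m s =
    (if s = 0 then return borel m else density lborel (normal_density m (sqrt s)))"

text \<open>A random vector is \<open>N(\<mu>, P)\<close>, with \<open>P\<close> possibly singular, when each of its linear
  functionals has the corresponding one-dimensional normal law.\<close>

definition gaussian :: "'w measure \<Rightarrow> ('w \<Rightarrow> real^'d) \<Rightarrow> real^'d \<Rightarrow> real^'d^'d \<Rightarrow> bool"
  where "gaussian M X \<mu> P \<longleftrightarrow>
    X \<in> borel_measurable M \<and>
    (\<forall>a. distr M borel (\<lambda>\<omega>. a \<bullet> X \<omega>) = normal_law (a \<bullet> \<mu>) (a \<bullet> (P *v a)))"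

text \<open>Independence of two random variables, as \<open>indep_var\<close> but allowing different value types.\<close>

definition indep_rv ::
  "'w measure \<Rightarrow> 'a measure \<Rightarrow> ('w \<Rightarrow> 'a) \<Rightarrow> 'b measure \<Rightarrow> ('w \<Rightarrow> 'b) \<Rightarrow> bool"
  where "indep_rv M S X T Y \<longleftrightarrow>
    X \<in> measurable M S \<and> Y \<in> measurable M T \<and>
    prob_space.indep_set M
      (sets (vimage_algebra (space M) X S)) (sets (vimage_algebra (space M) Y T))"


section \<open>Policies and closed-loop processes\<close>

text \<open>The argument \<open>m\<close> is the sequence of state means and \<open>xs\<close> the state history.\<close>

definition affine_policy ::
  "(nat \<Rightarrow> real^'m) \<Rightarrow> (nat \<Rightarrow> nat \<Rightarrow> real^'n^'m) \<Rightarrow> (nat \<Rightarrow> real^'n) \<Rightarrow> nat \<Rightarrow>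
   (nat \<Rightarrow> real^'n) \<Rightarrow> real^'m"
  where "affine_policy v K m k xs = v k + (\<Sum>i\<le>k. K k i *v (xs i - m i))"

definition markov_policy ::
  "(nat \<Rightarrow> real^'m) \<Rightarrow> (nat \<Rightarrow> real^'n^'m) \<Rightarrow> (nat \<Rightarrow> real^'n) \<Rightarrow> nat \<Rightarrow> real^'n \<Rightarrow> real^'m"
  where "markov_policy v H m k y = v k + H k *v (y - m k)"

text \<open>The policy at time \<open>k\<close> uses only times up to \<open>k\<close>, which justifies the recursion in the
  closed-loop state process.\<close>

lemma affine_policy_cong [fundef_cong]:
  assumes "v = v'" "K = K'" "k = k'"
    and "\<And>i. i \<le> k' \<Longrightarrow> m i = m' i"
    and "\<And>i. i \<le> k' \<Longrightarrow> xs i = xs' i"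
  shows "affine_policy v K m k xs = affine_policy v' K' m' k' xs'"
  using assms by (simp add: affine_policy_def)

fun state ::
  "'w measure \<Rightarrow> (nat \<Rightarrow> real^'n^'n) \<Rightarrow> (nat \<Rightarrow> real^'m^'n) \<Rightarrow> (nat \<Rightarrow> real^'l^'n) \<Rightarrow>
   ('w \<Rightarrow> real^'n) \<Rightarrow> (nat \<Rightarrow> 'w \<Rightarrow> real^'l) \<Rightarrow>
   (nat \<Rightarrow> real^'m) \<Rightarrow> (nat \<Rightarrow> nat \<Rightarrow> real^'n^'m) \<Rightarrow> nat \<Rightarrow> 'w \<Rightarrow> real^'n"
  where
    "state M A B G x0 w v K 0 = x0"
  | "state M A B G x0 w v K (Suc k) =
      (\<lambda>\<omega>. A k *v state M A B G x0 w v K k \<omega>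
         + B k *v affine_policy v K
             (\<lambda>i. integral\<^sup>L M (state M A B G x0 w v K i)) k
             (\<lambda>i. state M A B G x0 w v K i \<omega>)
         + G k *v w k \<omega>)"

definition control ::
  "'w measure \<Rightarrow> (nat \<Rightarrow> real^'n^'n) \<Rightarrow> (nat \<Rightarrow> real^'m^'n) \<Rightarrow> (nat \<Rightarrow> real^'l^'n) \<Rightarrow>
   ('w \<Rightarrow> real^'n) \<Rightarrow> (nat \<Rightarrow> 'w \<Rightarrow> real^'l) \<Rightarrow>
   (nat \<Rightarrow> real^'m) \<Rightarrow> (nat \<Rightarrow> nat \<Rightarrow> real^'n^'m) \<Rightarrow> nat \<Rightarrow> 'w \<Rightarrow> real^'m"
  where "control M A B G x0 w v K k \<omega> =
    affine_policy v K (\<lambda>i. integral\<^sup>L M (state M A B G x0 w v K i)) k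
      (\<lambda>i. state M A B G x0 w v K i \<omega>)"

definition markov_gain ::
  "'w measure \<Rightarrow> (nat \<Rightarrow> real^'m) \<Rightarrow> (nat \<Rightarrow> 'w \<Rightarrow> real^'n) \<Rightarrow> (nat \<Rightarrow> 'w \<Rightarrow> real^'m) \<Rightarrow>
   nat \<Rightarrow> real^'n^'m"
  where "markov_gain M v x u k =
    (LINT \<omega>|M. outer (u k \<omega> - v k) (x k \<omega> - integral\<^sup>L M (x k))) ** pinv (covariance M (x k))"


section \<open>The optimization problem\<close>

definition cost ::
  "'w measure \<Rightarrow> nat \<Rightarrow> (nat \<Rightarrow> real^'n^'n) \<Rightarrow> (nat \<Rightarrow> real^'m^'m) \<Rightarrow>
   (nat \<Rightarrow> 'w \<Rightarrow> real^'n) \<Rightarrow> (nat \<Rightarrow> 'w \<Rightarrow> real^'m) \<Rightarrow> real"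
  where "cost M N Q R x u =
    (\<Sum>k\<le>N. LINT \<omega>|M. x k \<omega> \<bullet> (Q k *v x k \<omega>)) +
    (\<Sum>k<N. LINT \<omega>|M. u k \<omega> \<bullet> (R k *v u k \<omega>))"

definition feasible ::
  "'w measure \<Rightarrow> nat \<Rightarrow> (real^'n \<Rightarrow> real^'n^'n \<Rightarrow> real) \<Rightarrow> (real^'m \<Rightarrow> real^'m^'m \<Rightarrow> real) \<Rightarrow>
   (nat \<Rightarrow> 'w \<Rightarrow> real^'n) \<Rightarrow> (nat \<Rightarrow> 'w \<Rightarrow> real^'m) \<Rightarrow> bool"
  where "feasible M N gx gu x u \<longleftrightarrow>
    (\<forall>k\<in>{1..N}. gx (integral\<^sup>L M (x k)) (covariance M (x k)) \<le> 0) \<and>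
    (\<forall>k<N. gu (integral\<^sup>L M (u k)) (covariance M (u k)) \<le> 0)"

text \<open>Entries of \<open>v\<close> and \<open>K\<close> with indices outside \<open>i \<le> k < N\<close> affect neither the cost nor the
  constraints, so minimizing over total functions is minimizing over the actual parameters.\<close>

definition optimal_affine ::
  "'w measure \<Rightarrow> nat \<Rightarrow> (nat \<Rightarrow> real^'n^'n) \<Rightarrow> (nat \<Rightarrow> real^'m^'n) \<Rightarrow> (nat \<Rightarrow> real^'l^'n) \<Rightarrow>
   ('w \<Rightarrow> real^'n) \<Rightarrow> (nat \<Rightarrow> 'w \<Rightarrow> real^'l) \<Rightarrow>
   (nat \<Rightarrow> real^'n^'n) \<Rightarrow> (nat \<Rightarrow> real^'m^'m) \<Rightarrow>
   (real^'n \<Rightarrow> real^'n^'n \<Rightarrow> real) \<Rightarrow> (real^'m \<Rightarrow> real^'m^'m \<Rightarrow> real) \<Rightarrow>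
   (nat \<Rightarrow> real^'m) \<Rightarrow> (nat \<Rightarrow> nat \<Rightarrow> real^'n^'m) \<Rightarrow> bool"
  where "optimal_affine M N A B G x0 w Q R gx gu v K \<longleftrightarrow>
    feasible M N gx gu (state M A B G x0 w v K) (control M A B G x0 w v K) \<and>
    (\<forall>v' K'.
      feasible M N gx gu (state M A B G x0 w v' K') (control M A B G x0 w v' K') \<longrightarrow>
      cost M N Q R (state M A B G x0 w v K) (control M A B G x0 w v K)
        \<le> cost M N Q R (state M A B G x0 w v' K') (control M A B G x0 w v' K'))"

end

theory Submission
  imports Defs
begin

text \<open>
  Split the centred control into its best linear estimate from the current state and a residual:
  \<open>u - v = H (x - \<mu>) + e\<close> with \<open>E[e (x - \<mu>)\<^sup>T] = 0\<close>. The Markovian policy with gains \<open>H\<close> is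
  itself state-history-affine and has the same means. Since \<open>e\<close> is uncorrelated with the state and
  the noise with both, dropping \<open>e\<close> can only decrease \<open>E[z\<^sup>T Q z]\<close> for the centred states and
  controls \<open>z\<close> and every \<open>Q \<succeq> 0\<close>, by induction over time. With \<open>Q = a a\<^sup>T\<close> this is the Loewner
  order of the covariances, so the Markovian policy is feasible; and it saves at least
  \<open>E[e\<^sup>T R e]\<close> in cost. Optimality forces \<open>e = 0\<close> almost surely, because \<open>R\<close> is positive definite.
\<close>

section \<open>Matrices\<close>

lemma inner_outer_mult: "z \<bullet> (outer a b *v y) = (z \<bullet> a) * (b \<bullet> y)"
proof -
  have "outer a b *v y = (b \<bullet> y) *\<^sub>R a"
    by (simp add: vec_eq_iff outer_def matrix_vector_mult_def inner_vec_def sum_distrib_left algebra_simps)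
  then show ?thesis by (simp add: mult.commute)
qed

lemma inner_outer_self: "x \<bullet> (outer z z *v x) = (z \<bullet> x)\<^sup>2"
  by (simp add: inner_outer_mult power2_eq_square inner_commute)

lemma transpose_outer [simp]: "transpose (outer a b) = outer b a"
  by (simp add: outer_def transpose_def vec_eq_iff mult.commute)

lemma psd_outer_self: "psd (outer z z)"
  by (simp add: psd_def inner_outer_self)

lemma inner_matrix_mult_transpose:
  "x \<bullet> ((T::real^'n^'m) *v y) = y \<bullet> (transpose T *v x)"
  by (metis dot_lmul_matrix inner_commute transpose_matrix_vector)

lemma matrix_add_rdistrib: "(B + C) ** A = B ** A + (C::real^'n^'m) ** A"
  by (simp add: matrix_matrix_mult_def vec_eq_iff distrib_right sum.distrib)

lemma matrix_diff_ldistrib: "A ** (B - C) = A ** B - A ** (C::real^'n^'m)"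
  by (simp add: matrix_matrix_mult_def vec_eq_iff right_diff_distrib sum_subtractf)

lemma matrix_diff_rdistrib: "(B - C) ** A = B ** A - (C::real^'n^'m) ** A"
  by (simp add: matrix_matrix_mult_def vec_eq_iff left_diff_distrib sum_subtractf)

lemma inner_congruence:
  "(F *v x) \<bullet> ((Q::real^'m^'m) *v (F *v x)) = x \<bullet> ((transpose F ** Q ** (F::real^'n^'m)) *v x)"
  by (metis inner_commute inner_matrix_mult_transpose matrix_vector_mul_assoc)

text \<open>The congruent form at \<open>z\<close> is the form of \<open>Q\<close> at
  \<open>F *v z\<close>. With \<open>inner_congruence\<close> this moves a closed-loop step from the
  state into the weight, which stays positive semidefinite.\<close>

lemma psd_congruence:
  assumes "psd (Q::real^'m^'m)"
  shows "psd (transpose F ** Q ** (F::real^'n^'m))"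
  unfolding psd_def
proof (intro conjI allI)
  show "transpose (transpose F ** Q ** F) = transpose F ** Q ** F"
    using assms by (simp add: psd_def matrix_transpose_mul matrix_mul_assoc)
  show "0 \<le> z \<bullet> ((transpose F ** Q ** F) *v z)" for z
    using assms by (simp add: psd_def flip: inner_congruence)
qed

lemma inner_matrix_mult_outer_sum:
  "a \<bullet> ((T::real^'n^'m) *v b) = (\<Sum>i\<in>UNIV. \<Sum>j\<in>UNIV. T $ i $ j * (a $ i * b $ j))"
  by (simp add: matrix_vector_mult_def inner_vec_def sum_distrib_left algebra_simps)

section \<open>Orthogonal projections and the pseudoinverse of a symmetric matrix\<close>

lemma orthogonal_projection_matrix_exists:
  fixes S :: "(real^'n) set"
  assumes S: "subspace S"
  obtains E :: "real^'n^'n" where "transpose E = E" "\<And>z. E *v z \<in> S" "\<And>z. z \<in> S \<Longrightarrow> E *v z = z"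
proof -
  obtain D where D: "D \<subseteq> S" "pairwise orthogonal D" "\<And>x. x \<in> D \<Longrightarrow> norm x = 1"
      "independent D" "span D = S"
    using orthonormal_basis_subspace[OF S] by metis
  have fin: "finite D" using D(4) independent_imp_finite by blast
  \<comment> \<open>The sum of \<open>b b^T\<close> over an orthonormal basis of \<open>S\<close>
    projects onto \<open>S\<close>: it fixes every basis vector, hence by linearity the whole
    span.\<close>
  define E where "E = (\<Sum>b\<in>D. outer b b)"
  have Ez: "E *v z = (\<Sum>b\<in>D. (b \<bullet> z) *\<^sub>R b)" for z
  proof -
    have o: "outer b b *v z = (b \<bullet> z) *\<^sub>R b" for b :: "real^'n"
      by (simp add: vec_eq_iff outer_def matrix_vector_mult_def inner_vec_def sum_distrib_right
          sum_distrib_left algebra_simps)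
    show ?thesis unfolding E_def using fin
      by (induction D rule: finite_induct)
        (simp_all add: o matrix_vector_mult_add_rdistrib)
  qed
  have "transpose E = E"
  proof -
    have "transpose (\<Sum>b\<in>D. outer b b) = (\<Sum>b\<in>D. transpose (outer b b))"
      by (simp add: transpose_def vec_eq_iff)
    then show ?thesis by (simp add: E_def)
  qed
  moreover have "E *v z \<in> S" for z
    unfolding Ez using D S by (intro subspace_sum subspace_scale) auto
  moreover have "E *v z = z" if "z \<in> S" for z
  proof -
    have ob: "E *v b = b" if "b \<in> D" for b
    proof -
      have "(\<Sum>c\<in>D. (c \<bullet> b) *\<^sub>R c) = (\<Sum>c\<in>D. if c = b then b else 0)"
      proof (rule sum.cong)
        fix c assume c: "c \<in> D"
        show "(c \<bullet> b) *\<^sub>R c = (if c = b then b else 0)"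
        proof (cases "c = b")
          case True
          then show ?thesis using D(3)[OF that] by (simp add: dot_square_norm)
        next
          case False
          then show ?thesis using D(2) c that by (simp add: pairwise_def orthogonal_def)
        qed
      qed simp
      then show ?thesis using fin that by (simp add: Ez)
    qed
    have "subspace {z. E *v z = z}"
      by (simp add: subspace_def matrix_vector_right_distrib matrix_vector_mult_scaleR)
    then have "span D \<subseteq> {z. E *v z = z}" using ob by (intro span_minimal) auto
    then show ?thesis using D that by (auto simp: Ez)
  qed
  ultimately show ?thesis using that by blast
qed

text \<open>With \<open>E\<close> the orthogonal projection onto the kernel of \<open>P\<close>, the matrix \<open>P + E\<close> is invertible
  and the pseudoinverse is \<open>(P + E)\<^sup>-\<^sup>1 - E\<close>.\<close>

lemma is_pinv_exists_symmetric:
  fixes P :: "real^'n^'n"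
  assumes sym: "transpose P = P"
  obtains X where "is_pinv P X"
proof -
  have "subspace {z. P *v z = 0}"
    by (simp add: subspace_def matrix_vector_right_distrib matrix_vector_mult_scaleR)
  from orthogonal_projection_matrix_exists[OF this]
  obtain E where E: "transpose E = E" "\<And>z. P *v (E *v z) = 0"
      "\<And>z. P *v z = 0 \<Longrightarrow> E *v z = z"
    unfolding mem_Collect_eq by blast
  have PE: "P ** E = 0"
    using E(2) by (simp add: matrix_eq matrix_vector_mul_assoc)
  have "transpose (P ** E) = E ** P" by (simp add: matrix_transpose_mul E(1) sym)
  then have EP: "E ** P = 0" by (simp add: PE transpose_def vec_eq_iff)
  have EE: "E ** E = E"
    using E(2,3) by (simp add: matrix_eq flip: matrix_vector_mul_assoc)
  \<comment> \<open>Applying \<open>E\<close> to \<open>(P + E) z = 0\<close> gives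
    \<open>E z = 0\<close>, since \<open>E P = 0\<close> and \<open>E E = E\<close>. Then
    \<open>P z = 0\<close> as well, and \<open>E\<close> fixes the kernel, so
    \<open>z = E z = 0\<close>.\<close>
  have "inj ((*v) (P + E))"
  proof (rule linear_injective_0[THEN iffD2, rule_format, OF matrix_vector_mul_linear])
    fix z assume z: "(P + E) *v z = 0"
    then have "E *v ((P + E) *v z) = 0" by simp
    then have Ez: "E *v z = 0"
      by (simp add: matrix_vector_mul_assoc matrix_add_ldistrib EP EE)
    then have "P *v z = 0" using z by (simp add: matrix_vector_mult_add_rdistrib)
    then show "z = 0" using E(3) Ez by simp
  qed
  then obtain Y where Y: "Y ** (P + E) = mat 1"
    using matrix_left_invertible_injective by blast
  then have Y': "(P + E) ** Y = mat 1" using matrix_left_right_inverse by blast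
  have EY: "E ** Y = E"
  proof -
    have "E = (E ** (P + E)) ** Y" by (metis Y' matrix_mul_assoc matrix_mul_rid)
    also have "E ** (P + E) = E" by (simp add: matrix_add_ldistrib EP EE)
    finally show ?thesis by simp
  qed
  have YE: "Y ** E = E"
  proof -
    have "E = Y ** ((P + E) ** E)" by (metis Y matrix_mul_assoc matrix_mul_lid)
    also have "(P + E) ** E = E" by (simp add: matrix_add_rdistrib PE EE)
    finally show ?thesis by simp
  qed
  define X where "X = Y - E"
  \<comment> \<open>Both products turn out to be the projection onto the orthogonal complement of
    the kernel, hence symmetric; the other two Penrose conditions then follow by multiplying
    out.\<close>
  have PX: "P ** X = mat 1 - E"
    using Y' by (simp add: X_def matrix_diff_ldistrib PE matrix_add_rdistrib EY eq_diff_eq)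
  have XP: "X ** P = mat 1 - E"
    using Y by (simp add: X_def matrix_diff_rdistrib EP matrix_add_ldistrib YE eq_diff_eq)
  have "is_pinv P X"
    unfolding is_pinv_def PX XP
    using E(1)
    by (auto simp: matrix_diff_rdistrib EP X_def matrix_diff_ldistrib EY EE)
      (auto simp: transpose_def vec_eq_iff mat_def)
  then show ?thesis using that by blast
qed

text \<open>Existence and \<open>is_pinv_unique\<close> make the definite description in
  \<open>pinv\<close> proper. This Penrose condition is the one on which the linear estimate
  rests.\<close>

lemma mult_pinv_mult_symmetric:
  assumes "transpose (P::real^'n^'n) = P"
  shows "P ** pinv P ** P = P"
proof -
  obtain X where X: "is_pinv P X" using is_pinv_exists_symmetric[OF assms] .
  then have "pinv P = X" unfolding pinv_def using is_pinv_unique by blast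
  then show ?thesis using X by (simp add: is_pinv_def)
qed

section \<open>Square-integrable random vectors\<close>

text \<open>The space L2: it is closed under the affine operations of the closed loop, and the inner
  product of two members is integrable.\<close>

definition square_integrable :: "'w measure \<Rightarrow> ('w \<Rightarrow> 'a::euclidean_space) \<Rightarrow> bool"
  where "square_integrable M X \<longleftrightarrow> X \<in> borel_measurable M \<and> integrable M (\<lambda>\<omega>. (norm (X \<omega>))\<^sup>2)"

text \<open>No centring: this says \<open>E[X Y\<^sup>T] = 0\<close>, which is zero covariance once \<open>X\<close> or \<open>Y\<close> has mean zero.\<close>

definition uncorrelated :: "'w measure \<Rightarrow> ('w \<Rightarrow> real^'a) \<Rightarrow> ('w \<Rightarrow> real^'b) \<Rightarrow> bool"
  where "uncorrelated M X Y \<longleftrightarrow> (\<forall>T. (LINT \<omega>|M. X \<omega> \<bullet> (T *v Y \<omega>)) = 0)"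

lemma square_integrable_bound:
  assumes X: "square_integrable M X" and Y: "Y \<in> borel_measurable M"
    and le: "\<And>\<omega>. norm (Y \<omega>) \<le> c * norm (X \<omega>)"
  shows "square_integrable M Y"
  unfolding square_integrable_def
proof
  have "integrable M (\<lambda>\<omega>. c\<^sup>2 * (norm (X \<omega>))\<^sup>2)"
    using X by (simp add: square_integrable_def)
  then show "integrable M (\<lambda>\<omega>. (norm (Y \<omega>))\<^sup>2)"
  proof (rule Bochner_Integration.integrable_bound)
    show "(\<lambda>\<omega>. (norm (Y \<omega>))\<^sup>2) \<in> borel_measurable M" using Y by measurable
    show "AE \<omega> in M. norm ((norm (Y \<omega>))\<^sup>2) \<le> norm (c\<^sup>2 * (norm (X \<omega>))\<^sup>2)"
      using power_mono[OF le norm_ge_zero] by (auto simp: power_mult_distrib)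
  qed
qed (rule Y)

lemma square_integrable_add:
  assumes X: "square_integrable M X" and Y: "square_integrable M Y"
  shows "square_integrable M (\<lambda>\<omega>. X \<omega> + Y \<omega>)"
  unfolding square_integrable_def
proof
  have m: "X \<in> borel_measurable M" "Y \<in> borel_measurable M"
    using X Y by (simp_all add: square_integrable_def)
  then show "(\<lambda>\<omega>. X \<omega> + Y \<omega>) \<in> borel_measurable M" by measurable
  have "integrable M (\<lambda>\<omega>. 2 * (norm (X \<omega>))\<^sup>2 + 2 * (norm (Y \<omega>))\<^sup>2)"
    using X Y by (simp add: square_integrable_def)
  then show "integrable M (\<lambda>\<omega>. (norm (X \<omega> + Y \<omega>))\<^sup>2)"
  proof (rule Bochner_Integration.integrable_bound)
    show "(\<lambda>\<omega>. (norm (X \<omega> + Y \<omega>))\<^sup>2) \<in> borel_measurable M" using m by measurable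
    have "(norm (x + y))\<^sup>2 \<le> 2 * (norm x)\<^sup>2 + 2 * (norm y)\<^sup>2" for x y :: 'b
    proof -
      have "(norm (x + y))\<^sup>2 \<le> (norm x + norm y)\<^sup>2"
        by (intro power_mono norm_triangle_ineq) simp
      also have "\<dots> \<le> 2 * (norm x)\<^sup>2 + 2 * (norm y)\<^sup>2"
        using zero_le_power2[of "norm x - norm y"] by (simp add: power2_eq_square algebra_simps)
      finally show ?thesis .
    qed
    then show "AE \<omega> in M. norm ((norm (X \<omega> + Y \<omega>))\<^sup>2)
        \<le> norm (2 * (norm (X \<omega>))\<^sup>2 + 2 * (norm (Y \<omega>))\<^sup>2)"
      by simp
  qed
qed

lemma square_integrable_linear:
  assumes "square_integrable M X" "bounded_linear f"
  shows "square_integrable M (\<lambda>\<omega>. f (X \<omega>))"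
proof (rule square_integrable_bound[OF assms(1), where c = "onorm f"])
  show "(\<lambda>\<omega>. f (X \<omega>)) \<in> borel_measurable M"
    using assms borel_measurable_continuous_onI[OF linear_continuous_on[OF assms(2)]]
    by (auto simp: square_integrable_def)
  show "norm (f (X \<omega>)) \<le> onorm f * norm (X \<omega>)" for \<omega>
    using onorm[OF assms(2)] .
qed

lemma square_integrable_matrix:
  "square_integrable M X \<Longrightarrow> square_integrable M (\<lambda>\<omega>. (T::real^'n^'m) *v X \<omega>)"
  by (rule square_integrable_linear) simp_all

lemma (in finite_measure) square_integrable_const: "square_integrable M (\<lambda>\<omega>. c)"
  by (simp add: square_integrable_def)

lemma square_integrable_sum:
  assumes "finite_measure M" "\<And>i. i \<in> I \<Longrightarrow> square_integrable M (X i)"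
  shows "square_integrable M (\<lambda>\<omega>. \<Sum>i\<in>I. X i \<omega>)"
  using assms(2)
  by (induction I rule: infinite_finite_induct)
    (simp_all add: square_integrable_add finite_measure.square_integrable_const[OF assms(1)])

lemma (in finite_measure) square_integrable_diff_const:
  "square_integrable M X \<Longrightarrow> square_integrable M (\<lambda>\<omega>. X \<omega> - c)"
  using square_integrable_add[OF _ square_integrable_const, of X "- c"] by simp

lemma square_integrable_inner_integrable:
  assumes X: "square_integrable M X" and Y: "square_integrable M Y"
  shows "integrable M (\<lambda>\<omega>. X \<omega> \<bullet> Y \<omega>)"
proof (rule Bochner_Integration.integrable_bound)
  show "integrable M (\<lambda>\<omega>. (norm (X \<omega>))\<^sup>2 + (norm (Y \<omega>))\<^sup>2)"
    using X Y by (simp add: square_integrable_def)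
  have m: "X \<in> borel_measurable M" "Y \<in> borel_measurable M"
    using X Y by (simp_all add: square_integrable_def)
  then show "(\<lambda>\<omega>. X \<omega> \<bullet> Y \<omega>) \<in> borel_measurable M" by measurable
  have "\<bar>x \<bullet> y\<bar> \<le> (norm x)\<^sup>2 + (norm y)\<^sup>2" for x y :: 'b
  proof -
    have "\<bar>x \<bullet> y\<bar> \<le> norm x * norm y" by (rule Cauchy_Schwarz_ineq2)
    also have "2 * (norm x * norm y) \<le> (norm x)\<^sup>2 + (norm y)\<^sup>2"
      using zero_le_power2[of "norm x - norm y"] by (simp add: power2_eq_square algebra_simps)
    finally show ?thesis by (smt (verit) zero_le_power2)
  qed
  then show "AE \<omega> in M. norm (X \<omega> \<bullet> Y \<omega>) \<le> norm ((norm (X \<omega>))\<^sup>2 + (norm (Y \<omega>))\<^sup>2)"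
    by simp
qed

lemma (in finite_measure) square_integrable_integrable:
  assumes X: "square_integrable M X"
  shows "integrable M X"
proof (rule Bochner_Integration.integrable_bound)
  show "integrable M (\<lambda>\<omega>. (norm (X \<omega>))\<^sup>2 + 1)"
    using X by (simp add: square_integrable_def)
  show "X \<in> borel_measurable M" using X by (simp add: square_integrable_def)
  have "norm x \<le> (norm x)\<^sup>2 + 1" for x :: 'b
    using zero_le_power2[of "norm x - 1/2"] by (simp add: power2_eq_square algebra_simps)
  then show "AE \<omega> in M. norm (X \<omega>) \<le> norm ((norm (X \<omega>))\<^sup>2 + 1)"
    by (simp add: abs_of_nonneg)
qed

lemma square_integrable_component:
  "square_integrable M X \<Longrightarrow> square_integrable M (\<lambda>\<omega>. (X \<omega> :: real^'n) $ i)"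
  by (rule square_integrable_linear) (simp_all add: bounded_linear_vec_nth)

lemma square_integrable_vecI:
  fixes X :: "'w \<Rightarrow> real^'n"
  assumes "X \<in> borel_measurable M" "\<And>i. integrable M (\<lambda>\<omega>. (X \<omega> $ i)\<^sup>2)"
  shows "square_integrable M X"
proof -
  have "(norm x)\<^sup>2 = (\<Sum>i\<in>UNIV. (x $ i)\<^sup>2)" for x :: "real^'n"
    by (simp add: norm_vec_def L2_set_def sum_nonneg)
  then show ?thesis using assms by (simp add: square_integrable_def)
qed

lemma square_integrable_outer_integrable:
  assumes X: "square_integrable M X" and Y: "square_integrable M Y"
  shows "integrable M (\<lambda>\<omega>. outer (X \<omega>) (Y \<omega>))"
proof -
  \<comment> \<open>Expansion in the matrix units \<open>axis i (axis j 1)\<close> reduces the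
    matrix-valued integrand to products of real components.\<close>
  have *: "outer a b = (\<Sum>i\<in>UNIV. \<Sum>j\<in>UNIV. (a $ i \<bullet> b $ j) *\<^sub>R axis i (axis j 1))"
    for a :: "real^'b" and b :: "real^'c"
    by (simp add: vec_eq_iff outer_def axis_def if_distrib if_distribR sum.If_cases cong: if_cong)
  show ?thesis unfolding *
    by (intro Bochner_Integration.integrable_sum integrable_scaleR_left
        square_integrable_inner_integrable square_integrable_component X Y)
qed

lemma integral_outer_nth:
  assumes "square_integrable M X" "square_integrable M Y"
  shows "(LINT \<omega>|M. outer (X \<omega>) (Y \<omega>)) $ i $ j = (LINT \<omega>|M. X \<omega> $ i * Y \<omega> $ j)"
proof -
  have "bounded_linear (\<lambda>T::real^'c^'b. T $ i $ j)"
    using bounded_linear_compose[OF bounded_linear_vec_nth bounded_linear_vec_nth] .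
  from integral_bounded_linear[OF this square_integrable_outer_integrable[OF assms]]
  show ?thesis by (simp add: outer_def)
qed

lemma integral_outer_inner:
  assumes "square_integrable M X" "square_integrable M Y"
  shows "a \<bullet> ((LINT \<omega>|M. outer (X \<omega>) (Y \<omega>)) *v b) = (LINT \<omega>|M. (a \<bullet> X \<omega>) * (Y \<omega> \<bullet> b))"
proof -
  have lin: "linear (\<lambda>T::real^'c^'b. a \<bullet> (T *v b))"
    by (rule linearI) (simp_all add: matrix_vector_mult_add_rdistrib inner_add_right
        flip: scaleR_matrix_vector_assoc)
  show ?thesis
    using integral_bounded_linear[OF linear_conv_bounded_linear[THEN iffD1, OF lin]
        square_integrable_outer_integrable[OF assms]]
    by (simp add: inner_outer_mult)
qed

section \<open>Uncorrelated random vectors\<close>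

lemma uncorrelatedI_components:
  assumes X: "square_integrable M X" and Y: "square_integrable M Y"
    and "\<And>i j. (LINT \<omega>|M. X \<omega> $ i * Y \<omega> $ j) = 0"
  shows "uncorrelated M X Y"
proof -
  have "integrable M (\<lambda>\<omega>. X \<omega> $ i * Y \<omega> $ j)" for i j
    using square_integrable_inner_integrable[OF X[THEN square_integrable_component]
        Y[THEN square_integrable_component]] by simp
  then show ?thesis using assms(3)
    by (simp add: uncorrelated_def inner_matrix_mult_outer_sum Bochner_Integration.integral_sum)
qed

text \<open>The test matrix ranges over all matrices, hence over all transposes.\<close>

lemma uncorrelated_sym: "uncorrelated M X Y \<Longrightarrow> uncorrelated M Y X"
  unfolding uncorrelated_def by (subst inner_matrix_mult_transpose) blast

text \<open>Testing against every matrix lets the extra factor be absorbed into the test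
  matrix.\<close>

lemma uncorrelated_matrix: "uncorrelated M X Y \<Longrightarrow> uncorrelated M X (\<lambda>\<omega>. T *v Y \<omega>)"
  by (simp add: uncorrelated_def matrix_vector_mul_assoc)

lemma uncorrelated_add:
  assumes "square_integrable M X" "square_integrable M Y" "square_integrable M Z"
    and "uncorrelated M X Y" "uncorrelated M X Z"
  shows "uncorrelated M X (\<lambda>\<omega>. Y \<omega> + Z \<omega>)"
  using assms
  by (simp add: uncorrelated_def matrix_vector_right_distrib inner_add_right
      Bochner_Integration.integral_add square_integrable_inner_integrable square_integrable_matrix)

lemma uncorrelated_zero: "uncorrelated M X (\<lambda>\<omega>. 0)"
  by (simp add: uncorrelated_def)

lemma uncorrelated_sum:
  assumes "finite_measure M" "square_integrable M X"
    and "\<And>i. i \<in> I \<Longrightarrow> square_integrable M (Y i)" "\<And>i. i \<in> I \<Longrightarrow> uncorrelated M X (Y i)"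
  shows "uncorrelated M X (\<lambda>\<omega>. \<Sum>i\<in>I. Y i \<omega>)"
  using assms(3,4)
  by (induction I rule: infinite_finite_induct)
    (simp_all add: uncorrelated_zero uncorrelated_add square_integrable_sum assms(1,2))

lemma (in finite_measure) uncorrelated_const:
  assumes "square_integrable M X" "integral\<^sup>L M X = 0"
  shows "uncorrelated M X (\<lambda>\<omega>. c)"
  using assms by (simp add: uncorrelated_def square_integrable_integrable)

text \<open>Pythagoras in L2: both cross terms vanish. This identity splits off, in turn, the mean,
  the noise and the residual.\<close>

lemma integral_quadratic_add:
  assumes X: "square_integrable M X" and Y: "square_integrable M Y" and XY: "uncorrelated M X Y"
  shows "(LINT \<omega>|M. (X \<omega> + Y \<omega>) \<bullet> (Q *v (X \<omega> + Y \<omega>)))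
    = (LINT \<omega>|M. X \<omega> \<bullet> (Q *v X \<omega>)) + (LINT \<omega>|M. Y \<omega> \<bullet> (Q *v Y \<omega>))"
proof -
  have "(LINT \<omega>|M. X \<omega> \<bullet> (Q *v Y \<omega>)) = 0" "(LINT \<omega>|M. Y \<omega> \<bullet> (Q *v X \<omega>)) = 0"
    using XY uncorrelated_sym[OF XY] by (simp_all add: uncorrelated_def)
  with X Y show ?thesis
    by (simp add: matrix_vector_right_distrib inner_add_left inner_add_right
      Bochner_Integration.integral_add square_integrable_inner_integrable square_integrable_matrix)
qed

text \<open>The deviation has mean zero, so it is uncorrelated with the constant
  \<open>E[X]\<close>.\<close>

lemma (in prob_space) integral_quadratic_shift:
  fixes X :: "'a \<Rightarrow> real^'n"
  assumes X: "square_integrable M X"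
  shows "(LINT \<omega>|M. X \<omega> \<bullet> (Q *v X \<omega>)) = integral\<^sup>L M X \<bullet> (Q *v integral\<^sup>L M X)
    + (LINT \<omega>|M. (X \<omega> - integral\<^sup>L M X) \<bullet> (Q *v (X \<omega> - integral\<^sup>L M X)))"
proof -
  let ?m = "integral\<^sup>L M X"
  have s: "square_integrable M (\<lambda>\<omega>. X \<omega> - ?m)"
    using X by (rule square_integrable_diff_const)
  have "integral\<^sup>L M (\<lambda>\<omega>. X \<omega> - ?m) = 0"
    using square_integrable_integrable[OF X] by (simp add: prob_space)
  then have "uncorrelated M (\<lambda>\<omega>. X \<omega> - ?m) (\<lambda>\<omega>. ?m)"
    by (rule uncorrelated_const[OF s])
  from integral_quadratic_add[OF s square_integrable_const this, of Q]
  show ?thesis by (simp add: prob_space)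
qed

lemma integral_quadratic_nonneg: "psd Q \<Longrightarrow> 0 \<le> (LINT \<omega>|M. X \<omega> \<bullet> (Q *v X \<omega>))"
  by (rule Bochner_Integration.integral_nonneg) (simp add: psd_def)

section \<open>Covariance matrices and the Loewner order\<close>

lemma (in prob_space) inner_covariance:
  assumes "square_integrable M X"
  shows "z \<bullet> (covariance M X *v z)
    = (LINT \<omega>|M. (X \<omega> - integral\<^sup>L M X) \<bullet> (outer z z *v (X \<omega> - integral\<^sup>L M X)))"
  using assms
  by (simp add: covariance_def integral_outer_inner square_integrable_diff_const inner_outer_mult
      inner_commute)

lemma (in prob_space) transpose_covariance:
  assumes "square_integrable M X"
  shows "transpose (covariance M X) = covariance M X"
  using assms
  by (simp add: vec_eq_iff transpose_def covariance_def integral_outer_nth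
      square_integrable_diff_const mult.commute)

lemma (in prob_space) psd_covariance: "square_integrable M X \<Longrightarrow> psd (covariance M X)"
  by (simp add: psd_def transpose_covariance inner_covariance integral_quadratic_nonneg
      psd_outer_self[unfolded psd_def] inner_outer_self)

text \<open>With the weight \<open>z z^T\<close> the hypothesis compares the variances of the
  functionals along \<open>z\<close>, which is the Loewner order tested at \<open>z\<close>.\<close>

lemma (in prob_space) loewner_le_covarianceI:
  assumes "square_integrable M X" "square_integrable M Y"
    and "\<And>Q. psd Q \<Longrightarrow>
      (LINT \<omega>|M. (X \<omega> - integral\<^sup>L M X) \<bullet> (Q *v (X \<omega> - integral\<^sup>L M X)))
      \<le> (LINT \<omega>|M. (Y \<omega> - integral\<^sup>L M Y) \<bullet> (Q *v (Y \<omega> - integral\<^sup>L M Y)))"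
  shows "loewner_le (covariance M X) (covariance M Y)"
proof -
  have "transpose (covariance M Y - covariance M X) = covariance M Y - covariance M X"
    using assms(1,2)[THEN transpose_covariance] by (simp add: transpose_def vec_eq_iff)
  then show ?thesis
    using assms(3)[OF psd_outer_self]
    by (simp add: loewner_le_def psd_def matrix_vector_mult_diff_rdistrib inner_diff_right
        inner_covariance[OF assms(1)] inner_covariance[OF assms(2)])
qed

text \<open>\<open>Y - C P\<^sup>\<dagger> X\<close>, with \<open>C = E[Y X\<^sup>T]\<close>, is the residual of the best linear estimate. The
  pseudoinverse suffices because \<open>z \<bullet> X\<close> vanishes almost surely for \<open>z\<close> in the kernel of
  \<open>P = E[X X\<^sup>T]\<close>, whence \<open>C P\<^sup>\<dagger> P = C\<close>.\<close>

lemma uncorrelated_residual: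
  assumes X: "square_integrable M X" and Y: "square_integrable M Y"
  defines "P \<equiv> LINT \<omega>|M. outer (X \<omega>) (X \<omega>)"
    and "C \<equiv> LINT \<omega>|M. outer (Y \<omega>) (X \<omega>)"
  shows "uncorrelated M (\<lambda>\<omega>. Y \<omega> - (C ** pinv P) *v X \<omega>) X"
proof -
  let ?H = "C ** pinv P"
  have P: "transpose P = P"
    using X by (simp add: P_def vec_eq_iff transpose_def integral_outer_nth mult.commute)
  have CP: "?H ** P = C"
  proof -
    have ker: "C *v z = 0" if z: "P *v z = 0" for z
    proof -
      have i: "integrable M (\<lambda>\<omega>. (X \<omega> \<bullet> z)\<^sup>2)"
        using square_integrable_linear[OF X bounded_linear_inner_left, of z]
        by (simp add: square_integrable_def)
      have "(LINT \<omega>|M. (X \<omega> \<bullet> z)\<^sup>2) = z \<bullet> (P *v z)"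
        using X by (simp add: P_def integral_outer_inner power2_eq_square inner_commute)
      then have "(LINT \<omega>|M. (X \<omega> \<bullet> z)\<^sup>2) = 0" using z by simp
      then have "AE \<omega> in M. (X \<omega> \<bullet> z)\<^sup>2 = 0"
        using integral_nonneg_eq_0_iff_AE[OF i] by simp
      then have ae: "AE \<omega> in M. X \<omega> \<bullet> z = 0" by simp
      have "a \<bullet> (C *v z) = 0" for a
      proof -
        have "a \<bullet> (C *v z) = (LINT \<omega>|M. (a \<bullet> Y \<omega>) * (X \<omega> \<bullet> z))"
          using X Y by (simp add: C_def integral_outer_inner)
        also have "\<dots> = 0"
          by (rule integral_eq_zero_AE) (use ae in auto)
        finally show ?thesis .
      qed
      then show ?thesis by (metis inner_eq_zero_iff)
    qed
    have "?H ** P *v z = C *v z" for z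
    proof -
      \<comment> \<open>By \<open>P P^+ P = P\<close> this difference lies in the kernel of
        \<open>P\<close>, so \<open>C\<close> annihilates it too.\<close>
      have "P *v (z - (pinv P ** P) *v z) = 0"
        using mult_pinv_mult_symmetric[OF P]
        by (simp add: matrix_vector_mult_diff_distrib matrix_vector_mul_assoc matrix_mul_assoc)
      from ker[OF this] show ?thesis
        by (simp add: matrix_vector_mult_diff_distrib matrix_vector_mul_assoc matrix_mul_assoc)
    qed
    then show ?thesis by (simp add: matrix_eq)
  qed
  have HX: "square_integrable M (\<lambda>\<omega>. - (?H *v X \<omega>))"
    using square_integrable_matrix[OF X, of "- ?H"]
    by (simp add: matrix_vector_mult_def sum_negf vec_eq_iff fun_eq_iff uminus_vec_def)
  show ?thesis
  proof (rule uncorrelatedI_components)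
    show s: "square_integrable M (\<lambda>\<omega>. Y \<omega> - ?H *v X \<omega>)"
      using square_integrable_add[OF Y HX] by simp
    fix i j
    \<comment> \<open>Entrywise this computes \<open>E[(Y - H X) X^T] = C - H P\<close>, which is
      zero by \<open>CP\<close>.\<close>
    have "(LINT \<omega>|M. (Y \<omega> - ?H *v X \<omega>) $ i * X \<omega> $ j)
      = (LINT \<omega>|M. Y \<omega> $ i * X \<omega> $ j - (\<Sum>k\<in>UNIV. ?H $ i $ k * (X \<omega> $ k * X \<omega> $ j)))"
      by (simp add: matrix_vector_mult_def left_diff_distrib sum_distrib_right mult.assoc)
    also have "\<dots> = C $ i $ j - (\<Sum>k\<in>UNIV. ?H $ i $ k * P $ k $ j)"
    proof -
      have i: "integrable M (\<lambda>\<omega>. Z \<omega> $ i * X \<omega> $ j)"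
        if "square_integrable M Z" for Z :: "'a \<Rightarrow> real^'d" and i j
        using square_integrable_inner_integrable[OF that[THEN square_integrable_component]
          X[THEN square_integrable_component]] by simp
      show ?thesis
        using X Y by (simp add: i Bochner_Integration.integral_diff Bochner_Integration.integral_sum
            C_def P_def integral_outer_nth)
    qed
    also have "\<dots> = C $ i $ j - (?H ** P) $ i $ j" by (simp add: matrix_matrix_mult_def)
    finally show "(LINT \<omega>|M. (Y \<omega> - ?H *v X \<omega>) $ i * X \<omega> $ j) = 0" by (simp add: CP)
  qed (rule X)
qed

section \<open>Gaussian random vectors\<close>

lemma normal_law_moments:
  assumes "0 \<le> s"
  shows "integrable (normal_law m s) (\<lambda>x. x\<^sup>2)" "integral\<^sup>L (normal_law m s) (\<lambda>x. x) = m"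
proof -
  have "integrable (normal_law m s) (\<lambda>x. x\<^sup>2) \<and> integral\<^sup>L (normal_law m s) (\<lambda>x. x) = m"
  proof (cases "s = 0")
    case True
    \<comment> \<open>Under the point mass at \<open>m\<close> the integrand is almost surely the
      constant \<open>m^2\<close>.\<close>
    have "integrable (return borel m) (\<lambda>x. x\<^sup>2)"
      by (rule integrable_cong_AE_imp[where g = "\<lambda>x. m\<^sup>2"])
        (auto simp: AE_return finite_measure.integrable_const prob_space_return
          prob_space.finite_measure)
    with True show ?thesis by (simp add: normal_law_def integral_return)
  next
    case False
    then have s: "0 < sqrt s" using assms by simp
    \<comment> \<open>The expansion \<open>x^2 = (x - m)^2 + 2 m (x - m) + m^2\<close> reduces the
      claim to central moments.\<close>
    have "integrable lborel (\<lambda>x. normal_density m (sqrt s) x * (x - m)^2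
        + (2 * m) * (normal_density m (sqrt s) x * (x - m)^1)
        + m\<^sup>2 * (normal_density m (sqrt s) x * (x - m)^0))"
      by (intro Bochner_Integration.integrable_add integrable_mult_right integrable_normal_moment s)
    also have "(\<lambda>x. normal_density m (sqrt s) x * (x - m)^2
        + (2 * m) * (normal_density m (sqrt s) x * (x - m)^1)
        + m\<^sup>2 * (normal_density m (sqrt s) x * (x - m)^0))
      = (\<lambda>x. normal_density m (sqrt s) x * x\<^sup>2)"
      by (rule ext) (simp add: power2_eq_square algebra_simps)
    finally show ?thesis
      using False integral_normal_moment_nz_1[OF s, of m]
      by (simp add: normal_law_def integrable_density integral_density)
  qed
  then show "integrable (normal_law m s) (\<lambda>x. x\<^sup>2)" "integral\<^sup>L (normal_law m s) (\<lambda>x. x) = m"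
    by auto
qed

text \<open>Components are linear functionals along the coordinate axes, so their laws are known;
  \<open>psd P\<close> makes the variances nonnegative.\<close>

lemma gaussian_square_integrable:
  assumes X: "gaussian M X m P" and P: "psd P"
  shows "square_integrable M X"
proof (rule square_integrable_vecI)
  show meas: "X \<in> borel_measurable M" using X by (simp add: gaussian_def)
  fix i
  have "integrable (distr M borel (\<lambda>\<omega>. axis i 1 \<bullet> X \<omega>)) (\<lambda>x. x\<^sup>2)"
    using X P normal_law_moments(1) by (simp add: gaussian_def psd_def)
  then have "integrable M (\<lambda>\<omega>. (axis i 1 \<bullet> X \<omega>)\<^sup>2)"
    using meas by (subst (asm) integrable_distr_eq) auto
  then show "integrable M (\<lambda>\<omega>. (X \<omega> $ i)\<^sup>2)" by (simp add: inner_axis')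
qed

text \<open>The parameter \<open>m\<close> enters only through the laws of functionals; testing with
  every \<open>a\<close> identifies it as the expectation.\<close>

lemma (in prob_space) gaussian_mean:
  assumes X: "gaussian M X m P" and P: "psd P"
  shows "integral\<^sup>L M X = m"
proof -
  have int: "integrable M X"
    using gaussian_square_integrable[OF assms] by (rule square_integrable_integrable)
  have meas: "X \<in> borel_measurable M" using X by (simp add: gaussian_def)
  have "integral\<^sup>L M X \<bullet> a = m \<bullet> a" for a
  proof -
    have "integral\<^sup>L (distr M borel (\<lambda>\<omega>. a \<bullet> X \<omega>)) (\<lambda>x. x) = a \<bullet> m"
      using X P normal_law_moments(2) by (simp add: gaussian_def psd_def)
    moreover have "integral\<^sup>L (distr M borel (\<lambda>\<omega>. a \<bullet> X \<omega>)) (\<lambda>x. x) = (LINT \<omega>|M. a \<bullet> X \<omega>)"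
      using meas by (subst integral_distr) auto
    ultimately show ?thesis using int by (simp add: inner_commute)
  qed
  then show ?thesis by (metis vector_eq_rdot)
qed

lemma psd_mat_1: "psd (mat 1)"
  by (simp add: psd_def)

section \<open>Independence implies zero correlation\<close>

text \<open>The expectation of each product of components factorizes, and the factor coming from
  \<open>Y\<close> is zero.\<close>

lemma (in prob_space) indep_var_uncorrelated:
  assumes X: "square_integrable M X" and Y: "square_integrable M Y" and mean: "integral\<^sup>L M Y = 0"
    and indep: "\<And>i j. indep_var borel (\<lambda>\<omega>. X \<omega> $ i) borel (\<lambda>\<omega>. Y \<omega> $ j)"
  shows "uncorrelated M X Y"
proof (rule uncorrelatedI_components[OF X Y])
  fix i j
  have "(LINT \<omega>|M. Y \<omega> $ j) = integral\<^sup>L M Y $ j"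
    using integral_bounded_linear[OF bounded_linear_vec_nth square_integrable_integrable[OF Y]] .
  moreover have "(LINT \<omega>|M. X \<omega> $ i * Y \<omega> $ j) = (LINT \<omega>|M. X \<omega> $ i) * (LINT \<omega>|M. Y \<omega> $ j)"
    using X Y by (intro indep_var_lebesgue_integral indep square_integrable_integrable
        square_integrable_component)
  ultimately show "(LINT \<omega>|M. X \<omega> $ i * Y \<omega> $ j) = 0" using mean by simp
qed

text \<open>Preimages under a composite are preimages under the inner variable, so the generated
  sigma-algebras shrink. Real-valued \<open>f\<close> and \<open>g\<close> thus lead from
  \<open>indep_rv\<close>, with its differing value types, to the product rule for
  expectations.\<close>

lemma (in prob_space) indep_rv_compose:
  assumes indep: "indep_rv M S X T Y" and f: "f \<in> measurable S S'" and g: "g \<in> measurable T T'"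
  shows "indep_var S' (f \<circ> X) T' (g \<circ> Y)"
proof -
  have X: "X \<in> measurable M S" and Y: "Y \<in> measurable M T"
    and set: "indep_set (sets (vimage_algebra (space M) X S)) (sets (vimage_algebra (space M) Y T))"
    using indep by (auto simp: indep_rv_def)
  have sub: "sigma_sets (space M) {(h \<circ> Z) -` A \<inter> space M | A. A \<in> sets L'}
      \<subseteq> sets (vimage_algebra (space M) Z L)"
    if Z: "Z \<in> measurable M L" and h: "h \<in> measurable L L'" for Z :: "'a \<Rightarrow> 'x" and L h L'
  proof -
    have "(h \<circ> Z) -` A \<inter> space M \<in> sets (vimage_algebra (space M) Z L)" if "A \<in> sets L'" for A
    proof -
      have "(h \<circ> Z) -` A \<inter> space M = Z -` (h -` A \<inter> space L) \<inter> space M"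
        using measurable_space[OF Z] by auto
      then show ?thesis
        using in_vimage_algebra[OF measurable_sets[OF h that], of Z "space M"] by simp
    qed
    then have "{(h \<circ> Z) -` A \<inter> space M | A. A \<in> sets L'} \<subseteq> sets (vimage_algebra (space M) Z L)"
      by blast
    from sets.sigma_sets_subset[OF this] show ?thesis by simp
  qed
  show ?thesis
    unfolding indep_var_eq
  proof (intro conjI)
    show "f \<circ> X \<in> measurable M S'" "g \<circ> Y \<in> measurable M T'"
      using X Y f g by (auto intro: measurable_comp)
    show "indep_set (sigma_sets (space M) {(f \<circ> X) -` A \<inter> space M | A. A \<in> sets S'})
        (sigma_sets (space M) {(g \<circ> Y) -` A \<inter> space M | A. A \<in> sets T'})"
      using set sub[OF X f] sub[OF Y g] unfolding indep_sets2_eq by blast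
  qed
qed

section \<open>The closed loop\<close>

lemma integral_matrix_vector_mult:
  "integrable M X \<Longrightarrow> (LINT \<omega>|M. (T::real^'n^'m) *v X \<omega>) = T *v integral\<^sup>L M X"
  by (rule integral_bounded_linear[OF matrix_vector_mul_bounded_linear])

text \<open>Retains the second-order consequences of normality and independence; the comparison of
  policies is an argument about first and second moments.\<close>

locale white_noise_system = prob_space M for M :: "'w measure" +
  fixes N :: nat
    and A :: "nat \<Rightarrow> real^'n^'n" and B :: "nat \<Rightarrow> real^'m^'n" and G :: "nat \<Rightarrow> real^'l^'n"
    and x0 :: "'w \<Rightarrow> real^'n" and w :: "nat \<Rightarrow> 'w \<Rightarrow> real^'l"
  assumes square_integrable_x0: "square_integrable M x0"
    and square_integrable_w: "k < N \<Longrightarrow> square_integrable M (w k)"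
    and mean_w: "k < N \<Longrightarrow> integral\<^sup>L M (w k) = 0"
    and uncorrelated_w_x0: "k < N \<Longrightarrow> uncorrelated M (w k) x0"
    and uncorrelated_w_w: "j < k \<Longrightarrow> k < N \<Longrightarrow> uncorrelated M (w k) (w j)"
begin

abbreviation "\<xi> \<equiv> state M A B G x0 w"
abbreviation "\<upsilon> \<equiv> control M A B G x0 w"

definition state_dev :: "(nat \<Rightarrow> real^'m) \<Rightarrow> (nat \<Rightarrow> nat \<Rightarrow> real^'n^'m) \<Rightarrow> nat \<Rightarrow> 'w \<Rightarrow> real^'n"
  where "state_dev v K k \<omega> = \<xi> v K k \<omega> - integral\<^sup>L M (\<xi> v K k)"

text \<open>Centring at \<open>v k\<close> makes the deviation linear in the state deviations at
  once; \<open>mean_control\<close> identifies \<open>v k\<close> as the mean for times up to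
  \<open>N\<close>.\<close>

definition control_dev :: "(nat \<Rightarrow> real^'m) \<Rightarrow> (nat \<Rightarrow> nat \<Rightarrow> real^'n^'m) \<Rightarrow> nat \<Rightarrow> 'w \<Rightarrow> real^'m"
  where "control_dev v K k \<omega> = \<upsilon> v K k \<omega> - v k"

lemma control_dev_eq: "control_dev v K k = (\<lambda>\<omega>. \<Sum>i\<le>k. K k i *v state_dev v K i \<omega>)"
  by (simp add: fun_eq_iff control_dev_def state_dev_def control_def affine_policy_def)

lemma control_eq: "\<upsilon> v K k = (\<lambda>\<omega>. v k + control_dev v K k \<omega>)"
  by (simp add: control_dev_def)

lemma state_Suc:
  "\<xi> v K (Suc k) = (\<lambda>\<omega>. A k *v \<xi> v K k \<omega> + B k *v \<upsilon> v K k \<omega> + G k *v w k \<omega>)"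
  by (simp add: control_def)

section \<open>Integrability and means along the closed loop\<close>

lemma square_integrable_control_devI:
  assumes "\<And>i. i \<le> k \<Longrightarrow> square_integrable M (\<xi> v K i)"
  shows "square_integrable M (control_dev v K k)"
  unfolding control_dev_eq
  using assms finite_measure_axioms
  by (intro square_integrable_sum square_integrable_matrix)
    (simp_all add: state_dev_def square_integrable_diff_const)

lemma square_integrable_state: "k \<le> N \<Longrightarrow> square_integrable M (\<xi> v K k)"
\<comment> \<open>The control at time \<open>j\<close> involves the whole history, so the induction
  must supply all earlier states.\<close>
proof (induction k rule: less_induct)
  case (less k)
  show ?case
  proof (cases k)
    case 0
    then show ?thesis by (simp add: square_integrable_x0)
  next
    case (Suc j)
    have "square_integrable M (control_dev v K j)"
      using less Suc by (intro square_integrable_control_devI) simp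
    then have "square_integrable M (\<upsilon> v K j)"
      unfolding control_eq by (intro square_integrable_add square_integrable_const)
    then show ?thesis
      unfolding Suc state_Suc using less Suc
      by (intro square_integrable_add square_integrable_matrix square_integrable_w) simp_all
  qed
qed

lemma square_integrable_state_dev: "k \<le> N \<Longrightarrow> square_integrable M (state_dev v K k)"
  by (simp add: state_dev_def[abs_def] square_integrable_state square_integrable_diff_const)

lemma square_integrable_control: "k \<le> N \<Longrightarrow> square_integrable M (\<upsilon> v K k)"
  unfolding control_eq
  by (intro square_integrable_add square_integrable_const square_integrable_control_devI
      square_integrable_state) simp

lemma square_integrable_control_dev: "k \<le> N \<Longrightarrow> square_integrable M (control_dev v K k)"
  by (intro square_integrable_control_devI square_integrable_state) simp

lemma mean_state_dev: "k \<le> N \<Longrightarrow> integral\<^sup>L M (state_dev v K k) = 0"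
  using square_integrable_integrable[OF square_integrable_state]
  by (simp add: state_dev_def[abs_def] prob_space)

lemma mean_control_dev: "k \<le> N \<Longrightarrow> integral\<^sup>L M (control_dev v K k) = 0"
  unfolding control_dev_eq
  by (simp add: Bochner_Integration.integral_sum integral_matrix_vector_mult mean_state_dev
      square_integrable_integrable square_integrable_matrix square_integrable_state_dev)

lemma mean_control: "k \<le> N \<Longrightarrow> integral\<^sup>L M (\<upsilon> v K k) = v k"
  unfolding control_eq
  using square_integrable_integrable[OF square_integrable_control_dev]
  by (simp add: mean_control_dev prob_space)

lemma mean_state_Suc:
  assumes "k < N"
  shows "integral\<^sup>L M (\<xi> v K (Suc k)) = A k *v integral\<^sup>L M (\<xi> v K k) + B k *v v k"
proof -
  have i: "integrable M (\<xi> v K k)" "integrable M (\<upsilon> v K k)" "integrable M (w k)"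
    using assms by (simp_all add: square_integrable_integrable square_integrable_state
        square_integrable_control square_integrable_w)
  have i': "integrable M (\<lambda>\<omega>. T *v X \<omega>)" if "integrable M X" for X :: "'w \<Rightarrow> real^'d" and T :: "real^'d^'n"
    using integrable_bounded_linear[OF matrix_vector_mul_bounded_linear that] .
  show ?thesis
    unfolding state_Suc using assms
    by (simp add: i i' integral_matrix_vector_mult mean_w mean_control)
qed

text \<open>The recursion \<open>mean_state_Suc\<close> contains \<open>v\<close> but no gain.
  Policies that share \<open>v\<close> therefore have the same mean terms in cost and
  constraints.\<close>

lemma mean_state_indep_gain:
  "k \<le> N \<Longrightarrow> integral\<^sup>L M (\<xi> v K k) = integral\<^sup>L M (\<xi> v K' k)"
proof (induction k)
  case (Suc k)
  then show ?case by (simp only: mean_state_Suc Suc_le_lessD less_imp_le_nat)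
qed simp

lemma state_dev_Suc:
  assumes "k < N"
  shows "state_dev v K (Suc k)
    = (\<lambda>\<omega>. A k *v state_dev v K k \<omega> + B k *v control_dev v K k \<omega> + G k *v w k \<omega>)"
  unfolding state_dev_def[abs_def] mean_state_Suc[OF assms] control_dev_def[abs_def]
  by (simp add: fun_eq_iff state_Suc matrix_vector_mult_diff_distrib del: state.simps)

section \<open>Noise uncorrelated with the past, and the resulting second moments\<close>

lemma uncorrelated_w_control_dev:
  assumes "k < N" "j \<le> N" "\<And>i. i \<le> j \<Longrightarrow> uncorrelated M (w k) (state_dev v K i)"
  shows "uncorrelated M (w k) (control_dev v K j)"
  unfolding control_dev_eq
  using assms finite_measure_axioms
  by (intro uncorrelated_sum square_integrable_w square_integrable_matrix
      square_integrable_state_dev uncorrelated_matrix) simp_all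

text \<open>Causality: the deviation at time \<open>j\<close> is built linearly from
  \<open>x0\<close>, its mean and the noises before \<open>j\<close>, each uncorrelated with
  \<open>w k\<close> when \<open>j \<le> k\<close>.\<close>

lemma uncorrelated_w_state_dev:
  "j \<le> k \<Longrightarrow> k < N \<Longrightarrow> uncorrelated M (w k) (state_dev v K j)"
proof (induction j rule: less_induct)
  case (less j)
  show ?case
  proof (cases j)
    case 0
    \<comment> \<open>The constant shift is uncorrelated with the noise because the noise has mean
      zero.\<close>
    have "state_dev v K 0 = (\<lambda>\<omega>. x0 \<omega> + - integral\<^sup>L M x0)"
      by (simp add: state_dev_def fun_eq_iff)
    then show ?thesis
      unfolding 0 using less.prems
      by (simp only:) (intro uncorrelated_add uncorrelated_const square_integrable_const
          square_integrable_w square_integrable_x0 mean_w uncorrelated_w_x0)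
  next
    case (Suc i)
    have "i < N" using Suc less.prems by simp
    then show ?thesis
      unfolding Suc state_dev_Suc[OF \<open>i < N\<close>] using less Suc
      by (intro uncorrelated_add uncorrelated_matrix square_integrable_add square_integrable_matrix
          uncorrelated_w_control_dev uncorrelated_w_w square_integrable_w
          square_integrable_state_dev square_integrable_control_dev) simp_all
  qed
qed

text \<open>The noise separates from the past; its contribution is the same for every policy and
  cancels in comparisons.\<close>

lemma quadratic_state_dev_Suc:
  assumes "k < N"
  shows "(LINT \<omega>|M. state_dev v K (Suc k) \<omega> \<bullet> (Q *v state_dev v K (Suc k) \<omega>))
    = (LINT \<omega>|M. (A k *v state_dev v K k \<omega> + B k *v control_dev v K k \<omega>)
        \<bullet> (Q *v (A k *v state_dev v K k \<omega> + B k *v control_dev v K k \<omega>)))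
    + (LINT \<omega>|M. (G k *v w k \<omega>) \<bullet> (Q *v (G k *v w k \<omega>)))"
  unfolding state_dev_Suc[OF assms]
proof (rule integral_quadratic_add)
  have s: "square_integrable M (state_dev v K k)" "square_integrable M (control_dev v K k)"
      "square_integrable M (w k)"
    using assms by (simp_all add: square_integrable_state_dev square_integrable_control_dev
        square_integrable_w)
  show "square_integrable M (\<lambda>\<omega>. A k *v state_dev v K k \<omega> + B k *v control_dev v K k \<omega>)"
    "square_integrable M (\<lambda>\<omega>. G k *v w k \<omega>)"
    using s by (simp_all add: square_integrable_add square_integrable_matrix)
  have "uncorrelated M (w k) (\<lambda>\<omega>. A k *v state_dev v K k \<omega> + B k *v control_dev v K k \<omega>)"
    using s assms by (intro uncorrelated_add uncorrelated_matrix square_integrable_matrix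
        uncorrelated_w_control_dev uncorrelated_w_state_dev) simp_all
  from uncorrelated_matrix[OF uncorrelated_sym[OF this]]
  show "uncorrelated M (\<lambda>\<omega>. A k *v state_dev v K k \<omega> + B k *v control_dev v K k \<omega>)
      (\<lambda>\<omega>. G k *v w k \<omega>)" .
qed

text \<open>Separates the mean part, fixed by \<open>v\<close>, from the deviation part, the only
  one in which the gains matter.\<close>

lemma cost_eq:
  "cost M N Q R (\<xi> v K) (\<upsilon> v K) =
    (\<Sum>k\<le>N. integral\<^sup>L M (\<xi> v K k) \<bullet> (Q k *v integral\<^sup>L M (\<xi> v K k))
      + (LINT \<omega>|M. state_dev v K k \<omega> \<bullet> (Q k *v state_dev v K k \<omega>)))
    + (\<Sum>k<N. v k \<bullet> (R k *v v k)
      + (LINT \<omega>|M. control_dev v K k \<omega> \<bullet> (R k *v control_dev v K k \<omega>)))"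
  unfolding cost_def
  by (intro arg_cong2[where f = "(+)"] sum.cong refl)
    (simp_all add: integral_quadratic_shift square_integrable_state square_integrable_control
      mean_control state_dev_def control_dev_def)

section \<open>The Markovian competitor and its second moments\<close>

definition residual :: "(nat \<Rightarrow> real^'m) \<Rightarrow> (nat \<Rightarrow> nat \<Rightarrow> real^'n^'m) \<Rightarrow> nat \<Rightarrow> 'w \<Rightarrow> real^'m"
  where "residual v K k \<omega>
    = control_dev v K k \<omega> - markov_gain M v (\<xi> v K) (\<upsilon> v K) k *v state_dev v K k \<omega>"

text \<open>The Markovian policy in history-affine form, with zero gains on the past, so that it
  competes in \<open>optimal_affine\<close>. Its gains come from the trajectory under
  \<open>K\<close>, not from the trajectory that it generates itself.\<close>

definition markov_gains :: "(nat \<Rightarrow> real^'m) \<Rightarrow> (nat \<Rightarrow> nat \<Rightarrow> real^'n^'m) \<Rightarrow> nat \<Rightarrow> nat \<Rightarrow> real^'n^'m"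
  where "markov_gains v K k i = (if i = k then markov_gain M v (\<xi> v K) (\<upsilon> v K) k else 0)"

lemma control_dev_markov:
  "control_dev v (markov_gains v K) k \<omega>
    = markov_gain M v (\<xi> v K) (\<upsilon> v K) k *v state_dev v (markov_gains v K) k \<omega>"
proof -
  have "control_dev v (markov_gains v K) k \<omega> = (\<Sum>i\<le>k. if i = k then
      markov_gain M v (\<xi> v K) (\<upsilon> v K) k *v state_dev v (markov_gains v K) k \<omega> else 0)"
    unfolding control_dev_eq by (intro sum.cong) (simp_all add: markov_gains_def)
  then show ?thesis by simp
qed

lemma control_dev_residual:
  "control_dev v K k \<omega>
    = markov_gain M v (\<xi> v K) (\<upsilon> v K) k *v state_dev v K k \<omega> + residual v K k \<omega>"
  by (simp add: residual_def)

lemma square_integrable_residual: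
  assumes "k \<le> N" shows "square_integrable M (residual v K k)"
proof -
  have "square_integrable M (\<lambda>\<omega>. control_dev v K k \<omega>
      + (- markov_gain M v (\<xi> v K) (\<upsilon> v K) k) *v state_dev v K k \<omega>)"
    using assms by (intro square_integrable_add square_integrable_matrix
        square_integrable_state_dev square_integrable_control_dev)
  also have "(\<lambda>\<omega>. control_dev v K k \<omega>
      + (- markov_gain M v (\<xi> v K) (\<upsilon> v K) k) *v state_dev v K k \<omega>) = residual v K k"
    by (simp add: fun_eq_iff residual_def matrix_vector_mult_def vec_eq_iff sum_negf)
  finally show ?thesis .
qed

text \<open>\<open>markov_gain\<close> is exactly the coefficient \<open>C P^+\<close> of the best
  linear estimate of \<open>control_dev\<close> from \<open>state_dev\<close>.\<close>

lemma uncorrelated_residual_state_dev: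
  assumes "k \<le> N" shows "uncorrelated M (residual v K k) (state_dev v K k)"
  using uncorrelated_residual[OF square_integrable_state_dev[OF assms, of v K]
      square_integrable_control_dev[OF assms, of v K]]
  unfolding residual_def[abs_def] markov_gain_def covariance_def
    state_dev_def[symmetric] control_dev_def[symmetric] .

lemma quadratic_control_dev:
  assumes "k \<le> N"
  shows "(LINT \<omega>|M. control_dev v K k \<omega> \<bullet> (R *v control_dev v K k \<omega>))
    = (LINT \<omega>|M. (markov_gain M v (\<xi> v K) (\<upsilon> v K) k *v state_dev v K k \<omega>)
        \<bullet> (R *v (markov_gain M v (\<xi> v K) (\<upsilon> v K) k *v state_dev v K k \<omega>)))
    + (LINT \<omega>|M. residual v K k \<omega> \<bullet> (R *v residual v K k \<omega>))"
  unfolding control_dev_residual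
  by (intro integral_quadratic_add uncorrelated_sym[OF uncorrelated_matrix]
      uncorrelated_residual_state_dev assms square_integrable_matrix square_integrable_state_dev square_integrable_residual)

text \<open>Induction over time with the weight left arbitrary, because one step backwards replaces
  \<open>Q\<close> by \<open>F^T Q F\<close>.\<close>

lemma quadratic_state_dev_markov_le:
  "k \<le> N \<Longrightarrow> psd Q \<Longrightarrow>
    (LINT \<omega>|M. state_dev v (markov_gains v K) k \<omega> \<bullet> (Q *v state_dev v (markov_gains v K) k \<omega>))
    \<le> (LINT \<omega>|M. state_dev v K k \<omega> \<bullet> (Q *v state_dev v K k \<omega>))"
proof (induction k arbitrary: Q)
  case 0
  then show ?case by (simp add: state_dev_def)
next
  case (Suc k)
  then have k: "k < N" "k \<le> N" by simp_all
  let ?K = "markov_gains v K"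
  \<comment> \<open>The closed-loop matrix under the Markovian gain; it drives both
    processes.\<close>
  define F where "F = A k + B k ** markov_gain M v (\<xi> v K) (\<upsilon> v K) k"
  have "A k *v state_dev v ?K k \<omega> + B k *v control_dev v ?K k \<omega> = F *v state_dev v ?K k \<omega>" for \<omega>
    by (simp add: F_def control_dev_markov matrix_vector_mult_add_rdistrib matrix_vector_mul_assoc)
  then have markov: "(LINT \<omega>|M. state_dev v ?K (Suc k) \<omega> \<bullet> (Q *v state_dev v ?K (Suc k) \<omega>))
      = (LINT \<omega>|M. state_dev v ?K k \<omega> \<bullet> ((transpose F ** Q ** F) *v state_dev v ?K k \<omega>))
        + (LINT \<omega>|M. (G k *v w k \<omega>) \<bullet> (Q *v (G k *v w k \<omega>)))"
    by (simp only: quadratic_state_dev_Suc[OF k(1)] inner_congruence)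
  \<comment> \<open>The original process carries the additional input \<open>B e\<close>,
    uncorrelated with the state, which can only add a nonnegative term.\<close>
  have split: "A k *v state_dev v K k \<omega> + B k *v control_dev v K k \<omega>
      = F *v state_dev v K k \<omega> + B k *v residual v K k \<omega>" for \<omega>
    unfolding control_dev_residual
    by (simp add: F_def matrix_vector_mult_add_rdistrib matrix_vector_mul_assoc
        matrix_vector_right_distrib)
  have "uncorrelated M (\<lambda>\<omega>. F *v state_dev v K k \<omega>) (\<lambda>\<omega>. B k *v residual v K k \<omega>)"
    using uncorrelated_residual_state_dev[OF k(2), of v K]
    by (blast intro: uncorrelated_sym uncorrelated_matrix)
  then have "(LINT \<omega>|M. state_dev v K (Suc k) \<omega> \<bullet> (Q *v state_dev v K (Suc k) \<omega>))
      = (LINT \<omega>|M. state_dev v K k \<omega> \<bullet> ((transpose F ** Q ** F) *v state_dev v K k \<omega>))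
        + (LINT \<omega>|M. (B k *v residual v K k \<omega>) \<bullet> (Q *v (B k *v residual v K k \<omega>)))
        + (LINT \<omega>|M. (G k *v w k \<omega>) \<bullet> (Q *v (G k *v w k \<omega>)))"
    unfolding quadratic_state_dev_Suc[OF k(1)] split
    using k by (subst integral_quadratic_add)
      (simp_all only: inner_congruence square_integrable_matrix square_integrable_state_dev
        square_integrable_residual)
  with markov Suc.IH[OF k(2) psd_congruence[OF Suc.prems(2), of F]]
    integral_quadratic_nonneg[OF Suc.prems(2), of M "\<lambda>\<omega>. B k *v residual v K k \<omega>"]
  show ?case by linarith
qed

text \<open>Two effects add up: the state deviations do not grow, and the residual is dropped. Its
  term is kept as the margin by which the cost falls.\<close>

lemma quadratic_control_dev_markov_le:
  assumes "k \<le> N" "psd R"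
  shows "(LINT \<omega>|M. control_dev v (markov_gains v K) k \<omega> \<bullet> (R *v control_dev v (markov_gains v K) k \<omega>))
      + (LINT \<omega>|M. residual v K k \<omega> \<bullet> (R *v residual v K k \<omega>))
    \<le> (LINT \<omega>|M. control_dev v K k \<omega> \<bullet> (R *v control_dev v K k \<omega>))"
  unfolding quadratic_control_dev[OF assms(1)] control_dev_markov inner_congruence
  using quadratic_state_dev_markov_le[OF assms(1) psd_congruence[OF assms(2)]] by simp

section \<open>Feasibility of the competitor and the use of optimality\<close>

lemma feasible_markov:
  assumes feas: "feasible M N gx gu (\<xi> v K) (\<upsilon> v K)"
    and mono: "covariance_monotonic gx" "covariance_monotonic gu"
  shows "feasible M N gx gu (\<xi> v (markov_gains v K)) (\<upsilon> v (markov_gains v K))"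
proof -
  let ?K = "markov_gains v K"
  have "gx (integral\<^sup>L M (\<xi> v ?K k)) (covariance M (\<xi> v ?K k)) \<le> 0" if k: "k \<in> {1..N}" for k
  proof -
    have "loewner_le (covariance M (\<xi> v ?K k)) (covariance M (\<xi> v K k))"
      using k quadratic_state_dev_markov_le[of k _ v K, unfolded state_dev_def]
      by (intro loewner_le_covarianceI square_integrable_state) auto
    \<comment> \<open>Monotonicity compares covariances at one common mean, here that of the
      original policy; the two means are identified afterwards.\<close>
    then have "gx (integral\<^sup>L M (\<xi> v K k)) (covariance M (\<xi> v ?K k))
        \<le> gx (integral\<^sup>L M (\<xi> v K k)) (covariance M (\<xi> v K k))"
      using mono(1) k unfolding covariance_monotonic_def
      by (meson atLeastAtMost_iff psd_covariance square_integrable_state)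
    moreover have "integral\<^sup>L M (\<xi> v ?K k) = integral\<^sup>L M (\<xi> v K k)"
      using k by (intro mean_state_indep_gain) simp
    ultimately show ?thesis using feas k unfolding feasible_def by force
  qed
  moreover have "gu (integral\<^sup>L M (\<upsilon> v ?K k)) (covariance M (\<upsilon> v ?K k)) \<le> 0" if "k < N" for k
  proof -
    have k: "k \<le> N" using that by simp
    have "loewner_le (covariance M (\<upsilon> v ?K k)) (covariance M (\<upsilon> v K k))"
    proof (rule loewner_le_covarianceI)
      fix S :: "real^'m^'m" assume S: "psd S"
      show "(LINT \<omega>|M. (\<upsilon> v ?K k \<omega> - integral\<^sup>L M (\<upsilon> v ?K k)) \<bullet> (S *v (\<upsilon> v ?K k \<omega> - integral\<^sup>L M (\<upsilon> v ?K k))))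
        \<le> (LINT \<omega>|M. (\<upsilon> v K k \<omega> - integral\<^sup>L M (\<upsilon> v K k)) \<bullet> (S *v (\<upsilon> v K k \<omega> - integral\<^sup>L M (\<upsilon> v K k))))"
        unfolding mean_control[OF k] control_dev_def[symmetric]
        using quadratic_control_dev_markov_le[OF k S, of v K]
          integral_quadratic_nonneg[OF S, of M "residual v K k"] by linarith
    qed (simp_all add: square_integrable_control k)
    then have "gu (v k) (covariance M (\<upsilon> v ?K k)) \<le> gu (v k) (covariance M (\<upsilon> v K k))"
      using mono(2) k unfolding covariance_monotonic_def
      by (meson psd_covariance square_integrable_control)
    then show ?thesis using feas that k unfolding feasible_def by (force simp: mean_control)
  qed
  ultimately show ?thesis by (simp add: feasible_def)
qed

lemma optimal_residual_zero:
  assumes Q: "\<And>k. k \<le> N \<Longrightarrow> psd (Q k)" and R: "\<And>k. k < N \<Longrightarrow> pos_def (R k)"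
    and mono: "covariance_monotonic gx" "covariance_monotonic gu"
    and opt: "optimal_affine M N A B G x0 w Q R gx gu v K" and k: "k < N"
  shows "AE \<omega> in M. residual v K k \<omega> = 0"
proof -
  let ?K = "markov_gains v K"
  let ?r = "\<lambda>k. LINT \<omega>|M. residual v K k \<omega> \<bullet> (R k *v residual v K k \<omega>)"
  have R': "psd (R k)" if "k < N" for k
    using R[OF that] unfolding pos_def_def psd_def
    by (metis inner_zero_left order.order_iff_strict)
  have le: "cost M N Q R (\<xi> v K) (\<upsilon> v K) \<le> cost M N Q R (\<xi> v ?K) (\<upsilon> v ?K)"
    using opt feasible_markov[OF _ mono] unfolding optimal_affine_def by blast
  \<comment> \<open>The residual terms are merged into the control sum, so the comparison is term by
    term: equal means, smaller state terms, and control terms that leave room for the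
    residual.\<close>
  have "cost M N Q R (\<xi> v ?K) (\<upsilon> v ?K) + sum ?r {..<N} \<le> cost M N Q R (\<xi> v K) (\<upsilon> v K)"
    unfolding cost_eq add.assoc sum.distrib[symmetric]
  proof (intro add_mono sum_mono)
    fix k assume "k \<in> {..N}"
    then show "integral\<^sup>L M (\<xi> v ?K k) \<bullet> (Q k *v integral\<^sup>L M (\<xi> v ?K k))
        \<le> integral\<^sup>L M (\<xi> v K k) \<bullet> (Q k *v integral\<^sup>L M (\<xi> v K k))"
      using mean_state_indep_gain[of k v ?K K] by simp
  qed (use Q R' in \<open>auto intro: quadratic_state_dev_markov_le quadratic_control_dev_markov_le\<close>)
  with le have "sum ?r {..<N} \<le> 0" by linarith
  moreover have nonneg: "0 \<le> ?r k" if "k < N" for k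
    using R'[OF that] by (rule integral_quadratic_nonneg)
  \<comment> \<open>Nonnegative summands with total at most zero: each of them vanishes.\<close>
  ultimately have "sum ?r {..<N} = 0" by (intro antisym sum_nonneg) auto
  then have 0: "?r k = 0" using k nonneg by (subst (asm) sum_nonneg_eq_0_iff) auto
  have "integrable M (\<lambda>\<omega>. residual v K k \<omega> \<bullet> (R k *v residual v K k \<omega>))"
    using k by (intro square_integrable_inner_integrable square_integrable_matrix
        square_integrable_residual) simp_all
  then have "AE \<omega> in M. residual v K k \<omega> \<bullet> (R k *v residual v K k \<omega>) = 0"
    using 0 R'[OF k] by (subst (asm) integral_nonneg_eq_0_iff_AE) (auto simp: psd_def)
  then show ?thesis
    using R[OF k] unfolding pos_def_def by (auto elim!: eventually_mono)
qed

end

theorem theorem1: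
  fixes M :: "'w measure"
    and N :: nat
    and A :: "nat \<Rightarrow> real^'n^'n" and B :: "nat \<Rightarrow> real^'m^'n" and G :: "nat \<Rightarrow> real^'l^'n"
    and x0 :: "'w \<Rightarrow> real^'n" and w :: "nat \<Rightarrow> 'w \<Rightarrow> real^'l"
    and \<mu>0 :: "real^'n" and P0 :: "real^'n^'n"
    and Q :: "nat \<Rightarrow> real^'n^'n" and R :: "nat \<Rightarrow> real^'m^'m"
    and gx :: "real^'n \<Rightarrow> real^'n^'n \<Rightarrow> real" and gu :: "real^'m \<Rightarrow> real^'m^'m \<Rightarrow> real"
    and v :: "nat \<Rightarrow> real^'m" and K :: "nat \<Rightarrow> nat \<Rightarrow> real^'n^'m"
    and x :: "nat \<Rightarrow> 'w \<Rightarrow> real^'n" and u :: "nat \<Rightarrow> 'w \<Rightarrow> real^'m" and \<mu> :: "nat \<Rightarrow> real^'n"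
  assumes "prob_space M"
    and "psd P0" and "gaussian M x0 \<mu>0 P0"
    and "\<And>k. k < N \<Longrightarrow> gaussian M (w k) 0 (mat 1)"
    and "prob_space.indep_vars M (\<lambda>_. borel) w {..<N}"
    and "indep_rv M borel x0
           (Pi\<^sub>M {..<N} (\<lambda>_. borel)) (\<lambda>\<omega>. \<lambda>k\<in>{..<N}. w k \<omega>)"
    and "\<And>k. k \<le> N \<Longrightarrow> psd (Q k)"
    and "\<And>k. k < N \<Longrightarrow> pos_def (R k)"
    and "covariance_monotonic gx" and "covariance_monotonic gu"
    and "optimal_affine M N A B G x0 w Q R gx gu v K"
  defines "x \<equiv> state M A B G x0 w v K"
    and "u \<equiv> control M A B G x0 w v K"
    and "\<mu> \<equiv> \<lambda>k. integral\<^sup>L M (x k)"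
  shows "\<forall>k<N. AE \<omega> in M.
    affine_policy v K \<mu> k (\<lambda>i. x i \<omega>) = markov_policy v (markov_gain M v x u) \<mu> k (x k \<omega>)"
proof (intro allI impI)
  fix k assume k: "k < N"
  interpret prob_space M by (rule assms(1))
  have sq_x0: "square_integrable M x0"
    using assms(3,2) by (rule gaussian_square_integrable)
  have sq_w: "square_integrable M (w i)" and mean_w: "integral\<^sup>L M (w i) = 0" if "i < N" for i
    using gaussian_square_integrable[OF assms(4)[OF that] psd_mat_1]
      gaussian_mean[OF assms(4)[OF that] psd_mat_1] by simp_all
  have nth: "(\<lambda>y::real^'d. y $ a) \<in> borel_measurable borel" for a
    by (intro borel_measurable_continuous_onI linear_continuous_on bounded_linear_vec_nth)
  have PiM_nth: "(\<lambda>h. h i $ a) \<in> borel_measurable (Pi\<^sub>M I (\<lambda>_. borel :: (real^'l) measure))"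
    if "i \<in> I" for i a I
    using measurable_compose[OF measurable_component_singleton[OF that] nth] .
  interpret white_noise_system M N A B G x0 w
  proof
    show "uncorrelated M (w i) x0" if i: "i < N" for i
    \<comment> \<open>The swap puts the noise second, where a mean-zero vector is required.\<close>
    proof (rule uncorrelated_sym, rule indep_var_uncorrelated[OF sq_x0 sq_w[OF i] mean_w[OF i]])
      fix a b
      have "indep_var borel ((\<lambda>y. y $ a) \<circ> x0)
          borel ((\<lambda>h. h i $ b) \<circ> (\<lambda>\<omega>. \<lambda>k\<in>{..<N}. w k \<omega>))"
        using i by (intro indep_rv_compose[OF assms(6)] nth PiM_nth) simp
      then show "indep_var borel (\<lambda>\<omega>. x0 \<omega> $ a) borel (\<lambda>\<omega>. w i \<omega> $ b)"
        using i by (simp add: comp_def)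
    qed
    show "uncorrelated M (w i) (w j)" if ji: "j < i" "i < N" for i j
    proof (rule uncorrelated_sym, rule indep_var_uncorrelated)
      fix a b
      \<comment> \<open>Restricting the independent family to the disjoint index sets
        \<open>{j}\<close> and \<open>{i}\<close> yields independence of the two single
        noises.\<close>
      have "indep_var borel ((\<lambda>h. h j $ a) \<circ> (\<lambda>\<omega>. \<lambda>k\<in>{j}. w k \<omega>))
          borel ((\<lambda>h. h i $ b) \<circ> (\<lambda>\<omega>. \<lambda>k\<in>{i}. w k \<omega>))"
        using ji by (intro indep_var_compose[OF indep_var_restrict[OF assms(5)]] PiM_nth) auto
      then show "indep_var borel (\<lambda>\<omega>. w j \<omega> $ a) borel (\<lambda>\<omega>. w i \<omega> $ b)"
        by (simp add: comp_def)
    qed (use ji in \<open>simp_all add: sq_w mean_w\<close>)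
  qed (simp_all add: sq_x0 sq_w mean_w)
  have "AE \<omega> in M. residual v K k \<omega> = 0"
    using assms(7-11) k by (rule optimal_residual_zero)
  then show "AE \<omega> in M. affine_policy v K \<mu> k (\<lambda>i. x i \<omega>)
      = markov_policy v (markov_gain M v x u) \<mu> k (x k \<omega>)"
  \<comment> \<open>Where the residual vanishes, adding \<open>v k\<close> back to the two
    deviations gives the two policies.\<close>
  proof (rule AE_mp, intro AE_I2 impI)
    fix \<omega> assume "residual v K k \<omega> = 0"
    then have "control_dev v K k \<omega> = markov_gain M v x u k *v state_dev v K k \<omega>"
      by (simp add: residual_def x_def u_def)
    then show "affine_policy v K \<mu> k (\<lambda>i. x i \<omega>)
        = markov_policy v (markov_gain M v x u) \<mu> k (x k \<omega>)"
      by (simp add: control_dev_def state_dev_def control_def markov_policy_def x_def \<mu>_def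
          diff_eq_eq add.commute)
  qed
qed

end
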